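(* Let $G=(V,E)$ be a finite, simple, connected graph that is AT-free and claw-free, and let $s$ be an admissible vertex of $G$. Then every BFS order of $G$ starting in $s$ is an AT-free order and a monotone dominating pair order of $G$.
   Context: A graph is claw-free if it has no induced $K_{1,3}$. An asteroidal triple is an independent set of three vertices such that for any two of them there is a path between them containing no neighbour of the third; $G$ is AT-free if it has none. A path $P$ avoids a vertex $v$ if $v$ has no neighbour on $P$. The domination betweenness $\mathcal{B}_D(G)$ is the set of triples $(x,y,z)$ of distinct vertices such that there is a chordless $x$-$y$-path avoiding $z$ and a chordless $y$-$z$-path avoiding $x$. A vertex $y$ is admissible if there are no $x,z$ with $(x,y,z)\in\mathcal{B}_D(G)$. An AT-free order is an ordering $\tau$ of $V$ such that for every $(x,y,z)\in\mathcal{B}_D(G)$ we have $y\prec_\tau x$ or $y\prec_\tau z$. Two vertices $a,b$ form a dominating pair of a graph $H$ if the vertex set of every $a$-$b$-path in $H$ is a dominating set of $H$. An ordering $\tau=(v_1,\ldots,v_n)$ is a monotone dominating pair order if for every $i$ the vertices $v_1,v_i$ form a dominating pair of $G[\{v_1,\ldots,v_i\}]$. A BFS order starting in $s$ is an ordering produced by a breadth-first search from $s$ with arbitrary tie-breaking. *)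

theory Defs
  imports "Graph_Theory.Graph_Theory"
begin

text \<open>
  A finite simple graph is a \<^term>\<open>graph G\<close>: every undirected edge is represented by its two
  opposite arcs, so \<^term>\<open>u \<rightarrow>\<^bsub>G\<^esub> v\<close> says that \<^term>\<open>u\<close> and \<^term>\<open>v\<close> are adjacent.
\<close>

definition path_between :: "('a,'b) pre_digraph \<Rightarrow> 'a \<Rightarrow> 'a list \<Rightarrow> 'a \<Rightarrow> bool" where
  "path_between G u p v \<longleftrightarrow> vpath p G \<and> hd p = u \<and> last p = v"

definition chordless :: "('a,'b) pre_digraph \<Rightarrow> 'a list \<Rightarrow> bool" where
  "chordless G p \<longleftrightarrow> (\<forall>i j. i + 1 < j \<and> j < length p \<longrightarrow> \<not> p ! i \<rightarrow>\<^bsub>G\<^esub> p ! j)"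

definition avoids :: "('a,'b) pre_digraph \<Rightarrow> 'a list \<Rightarrow> 'a \<Rightarrow> bool" where
  "avoids G p v \<longleftrightarrow> (\<forall>u \<in> set p. \<not> v \<rightarrow>\<^bsub>G\<^esub> u)"

definition induces_claw :: "('a,'b) pre_digraph \<Rightarrow> 'a \<Rightarrow> 'a \<Rightarrow> 'a \<Rightarrow> 'a \<Rightarrow> bool" where
  "induces_claw G c x y z \<longleftrightarrow>
     {c, x, y, z} \<subseteq> verts G \<and> distinct [c, x, y, z] \<and>
     arcs_ends (G \<restriction> {c, x, y, z}) = {(c, x), (x, c), (c, y), (y, c), (c, z), (z, c)}"

definition claw_free :: "('a,'b) pre_digraph \<Rightarrow> bool" where
  "claw_free G \<longleftrightarrow> \<not> (\<exists>c x y z. induces_claw G c x y z)"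

definition independent_set :: "('a,'b) pre_digraph \<Rightarrow> 'a set \<Rightarrow> bool" where
  "independent_set G S \<longleftrightarrow> S \<subseteq> verts G \<and> (\<forall>u \<in> S. \<forall>v \<in> S. \<not> u \<rightarrow>\<^bsub>G\<^esub> v)"

definition asteroidal_triple :: "('a,'b) pre_digraph \<Rightarrow> 'a \<Rightarrow> 'a \<Rightarrow> 'a \<Rightarrow> bool" where
  "asteroidal_triple G x y z \<longleftrightarrow>
     distinct [x, y, z] \<and> independent_set G {x, y, z} \<and>
     (\<exists>p. path_between G x p y \<and> avoids G p z) \<and>
     (\<exists>p. path_between G y p z \<and> avoids G p x) \<and>
     (\<exists>p. path_between G x p z \<and> avoids G p y)"

definition AT_free :: "('a,'b) pre_digraph \<Rightarrow> bool" where
  "AT_free G \<longleftrightarrow> \<not> (\<exists>x y z. asteroidal_triple G x y z)"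

definition domination_betweenness :: "('a,'b) pre_digraph \<Rightarrow> ('a \<times> 'a \<times> 'a) set" where
  "domination_betweenness G =
     {(x, y, z). {x, y, z} \<subseteq> verts G \<and> distinct [x, y, z] \<and>
        (\<exists>p. path_between G x p y \<and> chordless G p \<and> avoids G p z) \<and>
        (\<exists>p. path_between G y p z \<and> chordless G p \<and> avoids G p x)}"

definition admissible :: "('a,'b) pre_digraph \<Rightarrow> 'a \<Rightarrow> bool" where
  "admissible G y \<longleftrightarrow> y \<in> verts G \<and> \<not> (\<exists>x z. (x, y, z) \<in> domination_betweenness G)"

definition vertex_ordering :: "('a,'b) pre_digraph \<Rightarrow> 'a list \<Rightarrow> bool" where
  "vertex_ordering G \<tau> \<longleftrightarrow> distinct \<tau> \<and> set \<tau> = verts G"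

definition precedes :: "'a list \<Rightarrow> 'a \<Rightarrow> 'a \<Rightarrow> bool" where
  "precedes \<tau> u v \<longleftrightarrow> (\<exists>i j. i < j \<and> j < length \<tau> \<and> \<tau> ! i = u \<and> \<tau> ! j = v)"

definition AT_free_order :: "('a,'b) pre_digraph \<Rightarrow> 'a list \<Rightarrow> bool" where
  "AT_free_order G \<tau> \<longleftrightarrow> vertex_ordering G \<tau> \<and>
     (\<forall>(x, y, z) \<in> domination_betweenness G. precedes \<tau> y x \<or> precedes \<tau> y z)"

definition dominating_set :: "('a,'b) pre_digraph \<Rightarrow> 'a set \<Rightarrow> bool" where
  "dominating_set H D \<longleftrightarrow> D \<subseteq> verts H \<and> (\<forall>v \<in> verts H. v \<in> D \<or> (\<exists>u \<in> D. u \<rightarrow>\<^bsub>H\<^esub> v))"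

definition dominating_pair :: "('a,'b) pre_digraph \<Rightarrow> 'a \<Rightarrow> 'a \<Rightarrow> bool" where
  "dominating_pair H a b \<longleftrightarrow> a \<in> verts H \<and> b \<in> verts H \<and>
     (\<forall>p. path_between H a p b \<longrightarrow> dominating_set H (set p))"

definition monotone_dominating_pair_order :: "('a,'b) pre_digraph \<Rightarrow> 'a list \<Rightarrow> bool" where
  "monotone_dominating_pair_order G \<tau> \<longleftrightarrow> vertex_ordering G \<tau> \<and>
     (\<forall>i < length \<tau>. dominating_pair (G \<restriction> set (take (Suc i) \<tau>)) (\<tau> ! 0) (\<tau> ! i))"

text \<open>
  A state \<^term>\<open>bfs G s done queue\<close> of the search consists of the vertices already taken
  from the queue, in this order, and the queue itself. A step takes the first vertex \<^term>\<open>v\<close>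
  from the queue and appends the not yet discovered neighbours of \<^term>\<open>v\<close> in an arbitrary
  order \<^term>\<open>new\<close>.
\<close>

inductive bfs :: "('a,'b) pre_digraph \<Rightarrow> 'a \<Rightarrow> 'a list \<Rightarrow> 'a list \<Rightarrow> bool"
  for G :: "('a,'b) pre_digraph" and s :: 'a where
  start: "bfs G s [] [s]"
| step: "bfs G s done (v # queue) \<Longrightarrow> distinct new \<Longrightarrow>
    set new = {w \<in> verts G. v \<rightarrow>\<^bsub>G\<^esub> w \<and> w \<notin> set (done @ v # queue)} \<Longrightarrow>
    bfs G s (done @ [v]) (queue @ new)"

definition BFS_order :: "('a,'b) pre_digraph \<Rightarrow> 'a \<Rightarrow> 'a list \<Rightarrow> bool" where
  "BFS_order G s \<tau> \<longleftrightarrow> bfs G s \<tau> []"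

end

theory Submission
  imports Defs
begin

text \<open>
  A BFS order lists the vertices by non-decreasing distance from \<open>s\<close>. Let \<open>y\<close> have distance at
  least 2 from \<open>s\<close>, and let \<open>v\<close> be a non-neighbour of \<open>y\<close> that is not farther from \<open>s\<close> than \<open>y\<close>.
  Then every shortest path from \<open>s\<close> to \<open>v\<close> avoids \<open>y\<close>: a neighbour of \<open>y\<close> on it could only be the
  predecessor \<open>u\<close> of \<open>v\<close>, with \<open>v\<close> and \<open>y\<close> in the same layer, and then \<open>v\<close>, \<open>y\<close> and the predecessor
  of \<open>u\<close> form a claw with centre \<open>u\<close>.

  If \<open>(x, y, z)\<close> is a triple of the betweenness with \<open>y\<close> last, then joining such paths to \<open>x\<close> and to
  \<open>z\<close> turns it into an asteroidal triple. If a path from \<open>s\<close> to the last vertex \<open>y\<close> of a prefix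
  misses a vertex \<open>w\<close> of this prefix, then this path and a shortest path from \<open>s\<close> to \<open>w\<close> show that
  \<open>s\<close> lies between \<open>y\<close> and \<open>w\<close>, so \<open>s\<close> is not admissible.
\<close>

section \<open>Walks and chordless paths inside a vertex set\<close>

lemma vwalk_map_upt:
  assumes "\<And>i. i < n \<Longrightarrow> f i \<rightarrow>\<^bsub>G\<^esub> f (Suc i)" "\<And>i. i \<le> n \<Longrightarrow> f i \<in> verts G"
  shows "vwalk (map f [0..<Suc n]) G"
  using assms
proof (induction n)
  case (Suc n)
  have "vwalk (map f [0..<Suc n]) G"
    using Suc.prems by (intro Suc.IH) auto
  moreover have "map f [0..<Suc (Suc n)] = map f [0..<Suc n] @ [f (Suc n)]"
    by simp
  ultimately show ?case
    using Suc.prems(1)[of n] Suc.prems(2)[of "Suc n"]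
    by (simp add: vwalk_def vwalk_arcs_append del: upt_Suc) simp
qed simp

text \<open>A shortest walk inside \<open>S\<close> works: a chord has both ends in
  \<open>S\<close>, so it would be a shortcut inside \<open>S\<close>.\<close>

lemma chordless_path_within:
  assumes reach: "(u, v) \<in> (arcs_ends G \<inter> S \<times> S)\<^sup>*" and "u \<in> S" "S \<subseteq> verts G"
  obtains p where "path_between G u p v" "chordless G p" "set p \<subseteq> S"
proof -
  let ?R = "arcs_ends G \<inter> S \<times> S"
  define n where "n = (LEAST n. (u, v) \<in> ?R ^^ n)"
  have "(u, v) \<in> ?R ^^ n"
    unfolding n_def using reach LeastI_ex[of "\<lambda>n. (u, v) \<in> ?R ^^ n"]
    by (simp only: rtrancl_is_UN_relpow) blast
  then obtain f where f: "f 0 = u" "f n = v" and step: "\<And>i. i < n \<Longrightarrow> (f i, f (Suc i)) \<in> ?R"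
    by (auto simp: relpow_fun_conv)
  have min: "n \<le> m" if "(u, v) \<in> ?R ^^ m" for m
    unfolding n_def using that by (rule Least_le)
  have seg: "(f i, f (i + k)) \<in> ?R ^^ k" if "i + k \<le> n" for i k
    unfolding relpow_fun_conv using that step by (intro exI[of _ "\<lambda>l. f (i + l)"]) simp
  have pre: "(u, f i) \<in> ?R ^^ i" if "i \<le> n" for i
    using seg[of 0 i] that f by simp
  have suf: "(f j, v) \<in> ?R ^^ (n - j)" if "j \<le> n" for j
    using seg[of j "n - j"] that f by simp
  have in_S: "f i \<in> S" if "i \<le> n" for i
    using step[of "i - 1"] that f \<open>u \<in> S\<close> by (cases i) auto
  have neq: "f i \<noteq> f j" if "i < j" "j \<le> n" for i j
  proof
    assume "f i = f j"
    \<comment> \<open>Cutting out the closed segment from \<open>i\<close> to \<open>j\<close>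
      leaves a walk shorter than the minimum \<open>n\<close>.\<close>
    then have "(u, v) \<in> ?R ^^ (i + (n - j))"
      unfolding relpow_add using pre[of i] suf[of j] that by auto
    from min[OF this] that show False by simp
  qed
  have chord: "\<not> f i \<rightarrow>\<^bsub>G\<^esub> f j" if "i + 1 < j" "j \<le> n" for i j
  proof
    assume "f i \<rightarrow>\<^bsub>G\<^esub> f j"
    then have "(f i, f j) \<in> ?R" using in_S that by simp
    then have "(u, f j) \<in> ?R ^^ Suc i"
      using pre[of i] that by auto
    then have "(u, v) \<in> ?R ^^ (Suc i + (n - j))"
      unfolding relpow_add using suf[of j] that by blast
    from min[OF this] that show False by simp
  qed
  let ?p = "map f [0..<Suc n]"
  have "vwalk ?p G"
    using step in_S \<open>S \<subseteq> verts G\<close> by (intro vwalk_map_upt) auto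
  moreover have "distinct ?p"
    unfolding distinct_conv_nth
    by (auto simp del: upt_Suc) (metis neq less_Suc_eq_le linorder_neqE_nat)
  ultimately have "path_between G u ?p v"
    unfolding path_between_def vpath_def using f by (auto simp: hd_map last_map simp del: upt_Suc)
  moreover have "chordless G ?p"
    unfolding chordless_def using chord by (auto simp del: upt_Suc)
  moreover have "set ?p \<subseteq> S"
    using in_S by (auto simp del: upt_Suc)
  ultimately show thesis by (rule that)
qed

lemma vwalk_imp_rtrancl:
  assumes "vwalk p G" "set p \<subseteq> S"
  shows "(hd p, last p) \<in> (arcs_ends G \<inter> S \<times> S)\<^sup>*"
  using assms by (induction p rule: vwalk_induct) (auto intro: converse_rtrancl_into_rtrancl)

lemma arcs_ends_induce_subgraph:
  "arcs_ends (G \<restriction> S) = arcs_ends G \<inter> S \<times> S"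
  by (auto simp: arcs_ends_conv)

lemma vwalk_induce_subgraphD:
  assumes "vwalk p (G \<restriction> S)" "S \<subseteq> verts G"
  shows "vwalk p G"
  using assms by (auto simp: vwalk_def arcs_ends_induce_subgraph)

section \<open>Claws and asteroidal triples\<close>

lemma (in graph) adj_commute: "u \<rightarrow>\<^bsub>G\<^esub> v \<longleftrightarrow> v \<rightarrow>\<^bsub>G\<^esub> u"
  using graph_symmetric by blast

lemma (in graph) claw_freeD:
  assumes "claw_free G" "c \<rightarrow>\<^bsub>G\<^esub> x" "c \<rightarrow>\<^bsub>G\<^esub> y" "c \<rightarrow>\<^bsub>G\<^esub> z" "distinct [x, y, z]"
  shows "x \<rightarrow>\<^bsub>G\<^esub> y \<or> y \<rightarrow>\<^bsub>G\<^esub> z \<or> x \<rightarrow>\<^bsub>G\<^esub> z"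
proof (rule ccontr)
  assume *: "\<not> ?thesis"
  have loop: "\<not> u \<rightarrow>\<^bsub>G\<^esub> u" for u using adj_not_same by blast
  have sym: "x \<rightarrow>\<^bsub>G\<^esub> c" "y \<rightarrow>\<^bsub>G\<^esub> c" "z \<rightarrow>\<^bsub>G\<^esub> c" "\<not> y \<rightarrow>\<^bsub>G\<^esub> x" "\<not> z \<rightarrow>\<^bsub>G\<^esub> y" "\<not> z \<rightarrow>\<^bsub>G\<^esub> x"
    using * assms graph_symmetric by blast+
  have "{c, x, y, z} \<subseteq> verts G"
    using assms(2-4) adj_in_verts by blast
  moreover have "distinct [c, x, y, z]"
    using assms loop by auto
  moreover have "arcs_ends G \<inter> {c, x, y, z} \<times> {c, x, y, z} =
      {(c, x), (x, c), (c, y), (y, c), (c, z), (z, c)}"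
    using * assms(2-4) sym loop by auto
  ultimately have "induces_claw G c x y z"
    by (simp add: induces_claw_def arcs_ends_induce_subgraph)
  with assms(1) show False by (auto simp: claw_free_def)
qed

text \<open>The betweenness supplies two of the three paths, and avoidance at their ends gives
  independence; only the path from \<open>x\<close> to \<open>z\<close> is missing.\<close>

lemma (in graph) asteroidal_tripleI:
  assumes B: "(x, y, z) \<in> domination_betweenness G"
    and p: "path_between G x p z" "avoids G p y"
  shows "asteroidal_triple G x y z"
proof -
  from B obtain q r where q: "path_between G x q y" "avoids G q z"
    and r: "path_between G y r z" "avoids G r x"
    and V: "{x, y, z} \<subseteq> verts G" "distinct [x, y, z]"
    by (auto simp: domination_betweenness_def)
  have ends: "a \<in> set l \<and> b \<in> set l" if "path_between G a l b" for a b l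
    using that by (auto simp: path_between_def vpath_def vwalk_def)
  have "\<not> z \<rightarrow>\<^bsub>G\<^esub> x" "\<not> z \<rightarrow>\<^bsub>G\<^esub> y" "\<not> x \<rightarrow>\<^bsub>G\<^esub> y"
    using ends[OF q(1)] ends[OF r(1)] q(2) r(2) by (auto simp: avoids_def)
  then have "independent_set G {x, y, z}"
    unfolding independent_set_def using V adj_not_same adj_commute by blast
  with q r p V show ?thesis by (auto simp: asteroidal_triple_def)
qed

section \<open>Levels and paths from the root that avoid a vertex\<close>

text \<open>
  The assumptions characterise \<open>lev\<close> as the distance from \<open>s\<close>.
\<close>

locale levelled_graph = graph G for G :: "('a, 'b) pre_digraph" (structure) +
  fixes s :: 'a and lev :: "'a \<Rightarrow> nat"
  assumes root: "s \<in> verts G" and lev_root: "lev s = 0"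
    and lev_step: "u \<rightarrow>\<^bsub>G\<^esub> v \<Longrightarrow> lev v \<le> Suc (lev u)"
    and parent: "v \<in> verts G \<Longrightarrow> v \<noteq> s \<Longrightarrow> \<exists>u. u \<rightarrow>\<^bsub>G\<^esub> v \<and> lev v = Suc (lev u)"
begin

lemma lev_0_iff: "v \<in> verts G \<Longrightarrow> lev v = 0 \<longleftrightarrow> v = s"
  using parent lev_root by force

definition non_nbs :: "'a \<Rightarrow> 'a set" where
  "non_nbs y = {w \<in> verts G. \<not> y \<rightarrow>\<^bsub>G\<^esub> w}"

lemma avoids_iff: "set p \<subseteq> verts G \<Longrightarrow> avoids G p y \<longleftrightarrow> set p \<subseteq> non_nbs y"
  by (auto simp: avoids_def non_nbs_def)

text \<open>Avoidance is encoded as a relation so that paths can be joined by transitivity of its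
  closure and made chordless only at the end, by \<open>avoiding_path\<close>.\<close>

definition avoiding :: "'a \<Rightarrow> ('a \<times> 'a) set" where
  "avoiding y = arcs_ends G \<inter> non_nbs y \<times> non_nbs y"

lemma sym_avoiding: "sym (avoiding y)"
  by (auto simp: sym_def avoiding_def adj_commute)

lemma rtrancl_avoiding_sym: "(u, v) \<in> (avoiding y)\<^sup>* \<Longrightarrow> (v, u) \<in> (avoiding y)\<^sup>*"
  using sym_avoiding by (meson sym_rtrancl symD)

lemma avoiding_path:
  assumes "(u, v) \<in> (avoiding y)\<^sup>*" "u \<in> non_nbs y"
  obtains p where "path_between G u p v" "chordless G p" "avoids G p y"
proof -
  obtain p where "path_between G u p v" "chordless G p" "set p \<subseteq> non_nbs y"
    using chordless_path_within[of u v G "non_nbs y"] assms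
    by (auto simp: avoiding_def non_nbs_def)
  then show thesis
    using that avoids_iff[of p y] by (auto simp: path_between_def vpath_def vwalk_def)
qed

text \<open>A path of successive parents from \<open>w\<close> back to \<open>s\<close> stays at
  least two levels below \<open>lev y\<close>, where \<open>y\<close> has no neighbours.\<close>

lemma avoiding_from_root_lower:
  assumes "w \<in> verts G" "lev w + 2 \<le> lev y"
  shows "(s, w) \<in> (avoiding y)\<^sup>*"
  using assms
proof (induction "lev w" arbitrary: w)
  case 0
  then show ?case using lev_0_iff by simp
next
  case (Suc n)
  then obtain u where u: "u \<rightarrow>\<^bsub>G\<^esub> w" "lev w = Suc (lev u)"
    using parent lev_root by fastforce
  have "(s, u) \<in> (avoiding y)\<^sup>*"
    using Suc u adj_in_verts by auto
  moreover have "\<not> y \<rightarrow>\<^bsub>G\<^esub> w" "\<not> y \<rightarrow>\<^bsub>G\<^esub> u"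
    using Suc.prems u lev_step[of w y] lev_step[of u y] by (auto simp: adj_commute)
  then have "(u, w) \<in> avoiding y"
    using u adj_in_verts by (auto simp: avoiding_def non_nbs_def)
  ultimately show ?case by (rule rtrancl_into_rtrancl)
qed

lemma avoiding_from_root:
  assumes "claw_free G" "2 \<le> lev y" "y \<in> verts G" "v \<in> verts G" "v \<noteq> y" "\<not> y \<rightarrow>\<^bsub>G\<^esub> v" "lev v \<le> lev y"
  shows "(s, v) \<in> (avoiding y)\<^sup>*"
proof (cases "v = s")
  case False
  then obtain u where u: "u \<rightarrow>\<^bsub>G\<^esub> v" "lev v = Suc (lev u)"
    using parent \<open>v \<in> verts G\<close> by blast
  have uV: "u \<in> verts G" using u adj_in_verts by blast
  have "\<not> y \<rightarrow>\<^bsub>G\<^esub> u \<and> (s, u) \<in> (avoiding y)\<^sup>*"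
  proof (cases "lev v = lev y")
    case True
    then have "u \<noteq> s" using u lev_root \<open>2 \<le> lev y\<close> by auto
    then obtain q where q: "q \<rightarrow>\<^bsub>G\<^esub> u" "lev u = Suc (lev q)"
      using parent uV by blast
    have qV: "q \<in> verts G" using q adj_in_verts by blast
    \<comment> \<open>The levels of \<open>q\<close> and of both \<open>v\<close> and
      \<open>y\<close> differ by 2.\<close>
    have far: "\<not> q \<rightarrow>\<^bsub>G\<^esub> v" "\<not> q \<rightarrow>\<^bsub>G\<^esub> y" "\<not> y \<rightarrow>\<^bsub>G\<^esub> q"
      using lev_step[of q v] lev_step[of q y] graph_symmetric[of y q] u q True by auto
    have "\<not> y \<rightarrow>\<^bsub>G\<^esub> u"
    proof
      assume "y \<rightarrow>\<^bsub>G\<^esub> u"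
      then have "u \<rightarrow>\<^bsub>G\<^esub> y" "u \<rightarrow>\<^bsub>G\<^esub> q" using q graph_symmetric by blast+
      moreover have "distinct [q, v, y]" using u q True \<open>v \<noteq> y\<close> by auto
      ultimately have "q \<rightarrow>\<^bsub>G\<^esub> v \<or> v \<rightarrow>\<^bsub>G\<^esub> y \<or> q \<rightarrow>\<^bsub>G\<^esub> y"
        using claw_freeD[of u q v y] u \<open>claw_free G\<close> by blast
      then show False using far \<open>\<not> y \<rightarrow>\<^bsub>G\<^esub> v\<close> graph_symmetric by blast
    qed
    moreover have "(s, q) \<in> (avoiding y)\<^sup>*"
      using avoiding_from_root_lower[of q y] qV u q True by simp
    moreover have "(q, u) \<in> avoiding y"
      using q qV uV far calculation(1) by (simp add: avoiding_def non_nbs_def)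
    ultimately show ?thesis by (meson rtrancl_into_rtrancl)
  next
    case False
    then have "lev u + 2 \<le> lev y" using u \<open>lev v \<le> lev y\<close> by simp
    moreover have "\<not> y \<rightarrow>\<^bsub>G\<^esub> u"
      using calculation lev_step[of u y] graph_symmetric[of y u] by auto
    ultimately show ?thesis using avoiding_from_root_lower uV by blast
  qed
  moreover have "(u, v) \<in> avoiding y"
    using u uV calculation \<open>v \<in> verts G\<close> \<open>\<not> y \<rightarrow>\<^bsub>G\<^esub> v\<close> by (simp add: avoiding_def non_nbs_def)
  ultimately show ?thesis by (meson rtrancl_into_rtrancl)
qed simp

text \<open>The strict comparison of levels makes the result independent of tie-breaking. If it
  fails, \<open>lev y = 0\<close> contradicts distinctness, \<open>lev y = 1\<close> yields a claw
  centred at \<open>s\<close>, and higher levels yield an asteroidal triple.\<close>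

lemma betweenness_lev:
  assumes "claw_free G" "AT_free G" and B: "(x, y, z) \<in> domination_betweenness G"
  shows "lev y < lev x \<or> lev y < lev z"
proof (rule ccontr)
  assume "\<not> ?thesis"
  then have le: "lev x \<le> lev y" "lev z \<le> lev y" by auto
  from B obtain p q where p: "path_between G x p y" "avoids G p z"
    and q: "path_between G y q z" "avoids G q x"
    and V: "x \<in> verts G" "y \<in> verts G" "z \<in> verts G" and d: "distinct [x, y, z]"
    by (auto simp: domination_betweenness_def)
  have "x \<in> set p" "y \<in> set p" "y \<in> set q"
    using p(1) q(1) hd_in_set last_in_set
    unfolding path_between_def vpath_def vwalk_def by metis+
  then have na: "\<not> z \<rightarrow>\<^bsub>G\<^esub> x" "\<not> z \<rightarrow>\<^bsub>G\<^esub> y" "\<not> x \<rightarrow>\<^bsub>G\<^esub> y"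
    using p(2) q(2) by (auto simp: avoids_def)
  then have na': "\<not> x \<rightarrow>\<^bsub>G\<^esub> z" "\<not> y \<rightarrow>\<^bsub>G\<^esub> z" "\<not> y \<rightarrow>\<^bsub>G\<^esub> x"
    using graph_symmetric by blast+
  consider "lev y = 0" | "lev y = 1" | "2 \<le> lev y" by linarith
  then show False
  proof cases
    case 1
    then have "x = s" "y = s"
      using le(1) lev_0_iff[OF V(1)] lev_0_iff[OF V(2)] by linarith+
    then show False using d by simp
  next
    case 2
    have nb: "s \<rightarrow>\<^bsub>G\<^esub> w" if "w \<in> verts G" "lev w = 1" for w
      using that parent[of w] lev_root lev_0_iff adj_in_verts by force
    \<comment> \<open>The root is adjacent to \<open>y\<close>, whereas \<open>x\<close> and
      \<open>z\<close> are not.\<close>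
    have "x \<noteq> s" "z \<noteq> s" using nb[of y] V 2 na by auto
    then have "s \<rightarrow>\<^bsub>G\<^esub> x" "s \<rightarrow>\<^bsub>G\<^esub> y" "s \<rightarrow>\<^bsub>G\<^esub> z"
      using nb lev_0_iff V 2 le by (simp_all add: le_Suc_eq)
    then show False
      using claw_freeD[of s x y z] \<open>claw_free G\<close> d na na' by blast
  next
    case 3
    have "(s, x) \<in> (avoiding y)\<^sup>*" "(s, z) \<in> (avoiding y)\<^sup>*"
      using avoiding_from_root[of y] \<open>claw_free G\<close> 3 V d na' le by auto
    then have "(x, z) \<in> (avoiding y)\<^sup>*"
      using rtrancl_avoiding_sym by (meson rtrancl_trans)
    moreover have "x \<in> non_nbs y" using V na' by (simp add: non_nbs_def)
    ultimately obtain r where "path_between G x r z" "avoids G r y"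
      by (rule avoiding_path)
    with B asteroidal_tripleI \<open>AT_free G\<close> show False
      by (auto simp: AT_free_def)
  qed
qed

text \<open>The ordering enters only through \<open>lev w \<le> lev y\<close>, so this statement
  serves every prefix of a BFS order.\<close>

lemma admissible_root_dominates:
  assumes "claw_free G" "admissible G s"
    and p: "vwalk p G" "hd p = s" "last p = y"
    and w: "w \<in> verts G" "lev w \<le> lev y" "w \<notin> set p"
  shows "\<exists>u \<in> set p. u \<rightarrow>\<^bsub>G\<^esub> w"
proof (rule ccontr)
  assume not_dom: "\<not> ?thesis"
  have mem: "s \<in> set p" "y \<in> set p" and "y \<in> verts G"
    using p by (auto simp: vwalk_def)
  have na: "\<not> s \<rightarrow>\<^bsub>G\<^esub> w" "\<not> y \<rightarrow>\<^bsub>G\<^esub> w" "\<not> w \<rightarrow>\<^bsub>G\<^esub> s" "\<not> w \<rightarrow>\<^bsub>G\<^esub> y"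
    using not_dom mem graph_symmetric by blast+
  have "w \<noteq> s" "w \<noteq> y" using mem w by auto
  \<comment> \<open>At level 1 the parent of \<open>w\<close> would be \<open>s\<close>, which lies
    on \<open>p\<close> and so is not adjacent to \<open>w\<close>.\<close>
  have "2 \<le> lev w"
  proof (rule ccontr)
    assume "\<not> ?thesis"
    moreover obtain u where "u \<rightarrow>\<^bsub>G\<^esub> w" "lev w = Suc (lev u)"
      using parent w \<open>w \<noteq> s\<close> by blast
    moreover have "u \<in> verts G" using calculation adj_in_verts by blast
    ultimately show False using na lev_0_iff[of u] by auto
  qed
  then have "2 \<le> lev y" using w by simp
  then have "y \<noteq> s" using lev_root by auto
  have "(s, w) \<in> (avoiding y)\<^sup>*"
    using avoiding_from_root \<open>claw_free G\<close> \<open>2 \<le> lev y\<close> \<open>y \<in> verts G\<close> w \<open>w \<noteq> y\<close> na by blast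
  then have sw: "(w, s) \<in> (avoiding y)\<^sup>*"
    by (rule rtrancl_avoiding_sym)
  have "w \<in> non_nbs y" using w na by (simp add: non_nbs_def)
  with sw obtain q where q: "path_between G w q s" "chordless G q" "avoids G q y"
    by (rule avoiding_path)
  \<comment> \<open>The walk \<open>p\<close> itself joins \<open>s\<close> to \<open>y\<close>
    within the non-neighbours of \<open>w\<close>; a chordless path is then extracted from
    it.\<close>
  have "set p \<subseteq> non_nbs w"
    using p(1) not_dom by (auto simp: vwalk_def non_nbs_def adj_commute)
  then have "(s, y) \<in> (avoiding w)\<^sup>*" "s \<in> non_nbs w"
    using vwalk_imp_rtrancl[of p G "non_nbs w"] p mem by (auto simp: avoiding_def)
  then obtain r where r: "path_between G s r y" "chordless G r" "avoids G r w"
    by (rule avoiding_path)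
  have "(w, s, y) \<in> domination_betweenness G"
    unfolding domination_betweenness_def
    using q r w root \<open>y \<in> verts G\<close> \<open>w \<noteq> s\<close> \<open>w \<noteq> y\<close> \<open>y \<noteq> s\<close> by auto
  with \<open>admissible G s\<close> show False by (auto simp: admissible_def)
qed

section \<open>The invariant of breadth-first search\<close>

text \<open>The list \<open>done @ queue\<close> is the order of discovery, and the queue meets at
  most two consecutive levels. For an empty queue the clause with \<open>hd queue\<close> is
  vacuous.\<close>

definition bfs_inv :: "'a list \<Rightarrow> 'a list \<Rightarrow> bool" where
  "bfs_inv done queue \<longleftrightarrow>
     distinct (done @ queue) \<and> set (done @ queue) \<subseteq> verts G \<and>
     done @ queue \<noteq> [] \<and> hd (done @ queue) = s \<and>
     sorted (map lev (done @ queue)) \<and>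
     (\<forall>w \<in> set queue. lev w \<le> Suc (lev (hd queue))) \<and>
     (\<forall>u \<in> set done. \<forall>w. u \<rightarrow>\<^bsub>G\<^esub> w \<longrightarrow> w \<in> set (done @ queue))"

text \<open>By induction on the level: a parent of \<open>x\<close> is discovered and has level
  below \<open>lev v\<close>, hence it has left the queue, and all its neighbours are
  discovered.\<close>

lemma bfs_inv_discovered:
  assumes inv: "bfs_inv done (v # queue)" and "x \<in> verts G" "lev x \<le> lev v"
  shows "x \<in> set (done @ v # queue)"
  using assms(2,3)
proof (induction "lev x" arbitrary: x)
  case 0
  then have "x = s" using lev_0_iff by simp
  then show ?case using inv unfolding bfs_inv_def by (metis hd_in_set)
next
  case (Suc n)
  then obtain u where u: "u \<rightarrow>\<^bsub>G\<^esub> x" "lev x = Suc (lev u)"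
    using parent lev_root by fastforce
  then have "u \<in> set (done @ v # queue)"
    using Suc adj_in_verts by auto
  moreover have "lev v \<le> lev w" if "w \<in> set (v # queue)" for w
    using inv that by (auto simp: bfs_inv_def sorted_append)
  ultimately have "u \<in> set done"
    using u Suc.prems by fastforce
  then show ?case using inv u unfolding bfs_inv_def by blast
qed

lemma bfs_inv:
  assumes "bfs G s done queue"
  shows "bfs_inv done queue"
  using assms
proof induction
  case start
  then show ?case using root by (simp add: bfs_inv_def)
next
  case (step "done" v queue new)
  \<comment> \<open>This is what preserves the invariant: the new vertices share the level just
    after that of \<open>v\<close>, so appending them keeps the levels sorted.\<close>
  have new: "lev w = Suc (lev v)" if "w \<in> set new" for w
  proof -
    have w: "w \<in> verts G" "v \<rightarrow>\<^bsub>G\<^esub> w" "w \<notin> set (done @ v # queue)"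
      using that step.hyps by auto
    then have "\<not> lev w \<le> lev v"
      using bfs_inv_discovered step.IH by blast
    with lev_step[OF w(2)] show ?thesis by simp
  qed
  have inv: "distinct (done @ v # queue)" "set (done @ v # queue) \<subseteq> verts G"
    "hd (done @ v # queue) = s" "sorted (map lev (done @ v # queue))"
    "\<forall>w \<in> set queue. lev w \<le> Suc (lev v)"
    "\<forall>u \<in> set done. \<forall>w. u \<rightarrow>\<^bsub>G\<^esub> w \<longrightarrow> w \<in> set (done @ v # queue)"
    using step.IH by (auto simp: bfs_inv_def)
  have le: "lev w \<le> lev v" if "w \<in> set done" for w
    using inv(4) that by (auto simp: sorted_append)
  have "distinct (done @ v # queue @ new)" "set (done @ v # queue @ new) \<subseteq> verts G"
    using inv step.hyps by auto
  moreover have "hd (done @ v # queue @ new) = s"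
    using inv(3) by (cases "done") auto
  moreover have "sorted (map lev (done @ v # queue @ new))"
  proof -
    have "sorted (map lev new)"
      using new by (simp add: sorted_wrt_map sorted_wrt_iff_nth_less)
    then show ?thesis
      using inv(4,5) new le by (fastforce simp: sorted_append)
  qed
  moreover have "lev w \<le> Suc (lev (hd (queue @ new)))" if "w \<in> set (queue @ new)" for w
  proof -
    have "hd (queue @ new) \<in> set (queue @ new)"
      using that by (intro hd_in_set) auto
    then have "lev v \<le> lev (hd (queue @ new))"
      using inv(4) new by (auto simp: sorted_append)
    moreover have "lev w \<le> Suc (lev v)" using that inv(5) new by auto
    ultimately show ?thesis by simp
  qed
  moreover have "w \<in> set (done @ v # queue @ new)" if "u \<in> set (done @ [v])" "u \<rightarrow>\<^bsub>G\<^esub> w" for u w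
    using that inv(6) step.hyps adj_in_verts by auto
  ultimately show ?case by (simp add: bfs_inv_def)
qed

text \<open>Once the queue is empty, \<open>\<tau>\<close> contains \<open>s\<close> and is closed
  under adjacency, so induction along parents reaches every vertex.\<close>

lemma BFS_orderD:
  assumes "BFS_order G s \<tau>"
  shows "distinct \<tau>" "set \<tau> = verts G" "\<tau> \<noteq> []" "hd \<tau> = s" "sorted (map lev \<tau>)"
proof -
  have inv: "bfs_inv \<tau> []"
    using assms bfs_inv by (simp add: BFS_order_def)
  then show "distinct \<tau>" "\<tau> \<noteq> []" "hd \<tau> = s" "sorted (map lev \<tau>)"
    by (auto simp: bfs_inv_def)
  have "v \<in> set \<tau>" if "v \<in> verts G" for v
    using that
  proof (induction "lev v" arbitrary: v)
    case 0
    then show ?case using lev_0_iff \<open>\<tau> \<noteq> []\<close> \<open>hd \<tau> = s\<close> by auto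
  next
    case (Suc n)
    then obtain u where "u \<rightarrow>\<^bsub>G\<^esub> v" "lev v = Suc (lev u)"
      using parent lev_root by fastforce
    then show ?case using Suc inv adj_in_verts by (auto simp: bfs_inv_def)
  qed
  then show "set \<tau> = verts G" using inv by (auto simp: bfs_inv_def)
qed

section \<open>The two properties of BFS orders\<close>

lemma BFS_order_AT_free_order:
  assumes "claw_free G" "AT_free G" "BFS_order G s \<tau>"
  shows "AT_free_order G \<tau>"
proof -
  note bfs = BFS_orderD[OF assms(3)]
  have prec: "precedes \<tau> u v" if uv: "u \<in> verts G" "v \<in> verts G" "lev u < lev v" for u v
  proof -
    obtain i j where ij: "i < length \<tau>" "\<tau> ! i = u" "j < length \<tau>" "\<tau> ! j = v"
      using uv(1,2) bfs(2) by (metis in_set_conv_nth)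
    moreover have "\<not> j \<le> i"
    proof
      assume "j \<le> i"
      then have "lev v \<le> lev u"
        using sorted_nth_mono[OF bfs(5), of j i] ij by simp
      with uv show False by simp
    qed
    ultimately show ?thesis
      unfolding precedes_def by (intro exI[of _ i] exI[of _ j]) simp
  qed
  have "precedes \<tau> y x \<or> precedes \<tau> y z" if "(x, y, z) \<in> domination_betweenness G" for x y z
    using betweenness_lev[OF assms(1,2) that] that prec by (auto simp: domination_betweenness_def)
  then show ?thesis
    using bfs by (auto simp: AT_free_order_def vertex_ordering_def)
qed

text \<open>A path in the subgraph induced by a prefix is a walk in \<open>G\<close>, and sortedness
  bounds all levels in the prefix by that of its last vertex.\<close>

lemma BFS_order_monotone_dominating_pair_order:
  assumes "claw_free G" "admissible G s" "BFS_order G s \<tau>"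
  shows "monotone_dominating_pair_order G \<tau>"
proof -
  note bfs = BFS_orderD[OF assms(3)]
  have "dominating_pair (G \<restriction> set (take (Suc i) \<tau>)) (\<tau> ! 0) (\<tau> ! i)" if i: "i < length \<tau>" for i
  proof -
    let ?S = "set (take (Suc i) \<tau>)"
    have S: "?S \<subseteq> verts G" using bfs(2) set_take_subset by fast
    have S_nth: "?S = nth \<tau> ` {0..<Suc i}"
      using i by (intro nth_image[symmetric]) simp
    have "dominating_set (G \<restriction> ?S) (set p)" if p: "path_between (G \<restriction> ?S) (\<tau> ! 0) p (\<tau> ! i)" for p
    proof -
      have walk: "vwalk p (G \<restriction> ?S)" "hd p = s" "last p = \<tau> ! i"
        using p bfs by (auto simp: path_between_def vpath_def hd_conv_nth)
      then have pS: "set p \<subseteq> ?S" by (simp add: vwalk_def)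
      have "w \<in> set p \<or> (\<exists>u \<in> set p. u \<rightarrow>\<^bsub>G\<^esub> w)" if "w \<in> ?S" for w
      proof -
        obtain j where "j \<le> i" "w = \<tau> ! j"
          using \<open>w \<in> ?S\<close> unfolding S_nth by (auto simp: less_Suc_eq_le)
        then have "lev w \<le> lev (\<tau> ! i)"
          using sorted_nth_mono[OF bfs(5), of j i] i by simp
        then show ?thesis
          using admissible_root_dominates[OF assms(1,2) vwalk_induce_subgraphD[OF walk(1) S] walk(2,3)]
            that S by blast
      qed
      then show ?thesis
        using pS unfolding dominating_set_def arcs_ends_induce_subgraph by auto
    qed
    moreover have "\<tau> ! 0 \<in> ?S" "\<tau> ! i \<in> ?S" unfolding S_nth by auto
    ultimately show ?thesis by (simp add: dominating_pair_def)
  qed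
  then show ?thesis
    using bfs by (auto simp: monotone_dominating_pair_order_def vertex_ordering_def)
qed

end

section \<open>Distance from the root as a levelling\<close>

text \<open>Connectedness makes each \<open>LEAST\<close> attained; the parent of a vertex is its
  predecessor on a shortest walk from \<open>s\<close>.\<close>

lemma (in graph) levelled_graph_distance:
  assumes "Digraph_Component.connected G" "s \<in> verts G"
  shows "levelled_graph G s (\<lambda>v. LEAST n. (s, v) \<in> arcs_ends G ^^ n)"
proof -
  let ?lev = "\<lambda>v. LEAST n. (s, v) \<in> arcs_ends G ^^ n"
  have reach: "(s, v) \<in> arcs_ends G ^^ ?lev v" if "v \<in> verts G" for v
  proof -
    have "s \<rightarrow>\<^sup>*\<^bsub>mk_symmetric G\<^esub> v"
      using assms that by (auto simp: Digraph_Component.connected_def strongly_connected_def)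
    then have "s \<rightarrow>\<^sup>*\<^bsub>G\<^esub> v"
      using reachable_mk_symmetric_eq[OF sym_arcs] by simp
    then have "(s, v) \<in> (arcs_ends G)\<^sup>*"
      by (rule reachable_rtranclI)
    then show ?thesis
      using LeastI_ex[of "\<lambda>n. (s, v) \<in> arcs_ends G ^^ n"]
      by (simp only: rtrancl_is_UN_relpow) blast
  qed
  have le: "?lev v \<le> n" if "(s, v) \<in> arcs_ends G ^^ n" for v n
    using that by (rule Least_le)
  have step: "?lev v \<le> Suc (?lev u)" if "u \<rightarrow>\<^bsub>G\<^esub> v" for u v
    using reach[of u] adj_in_verts(1)[OF that] that by (intro le) auto
  show ?thesis
  proof unfold_locales
    show "s \<in> verts G" by fact
    show "?lev s = 0" using le[of s 0] by simp
    show "?lev v \<le> Suc (?lev u)" if "u \<rightarrow>\<^bsub>G\<^esub> v" for u v using that by (rule step)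
    show "\<exists>u. u \<rightarrow>\<^bsub>G\<^esub> v \<and> ?lev v = Suc (?lev u)" if v: "v \<in> verts G" "v \<noteq> s" for v
    proof (cases "?lev v")
      case 0
      then show ?thesis using reach[OF v(1)] v(2) by simp
    next
      case (Suc n)
      then obtain u where u: "(s, u) \<in> arcs_ends G ^^ n" "u \<rightarrow>\<^bsub>G\<^esub> v"
        using reach[OF v(1)] by auto
      \<comment> \<open>The walk to \<open>u\<close> gives \<open>?lev u \<le> n\<close>, and the
        arc to \<open>v\<close> gives \<open>Suc n \<le> Suc (?lev u)\<close>.\<close>
      have "?lev v = Suc (?lev u)"
        using le[OF u(1)] step[OF u(2)] Suc by linarith
      with u show ?thesis by blast
    qed
  qed
qed

theorem theorem5:
  fixes G :: "('a, 'b) pre_digraph" and s :: 'a and \<tau> :: "'a list"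
  assumes "graph G"
    and "Digraph_Component.connected G"
    and "AT_free G"
    and "claw_free G"
    and "admissible G s"
    and "BFS_order G s \<tau>"
  shows "AT_free_order G \<tau> \<and> monotone_dominating_pair_order G \<tau>"
proof -
  interpret graph G by fact
  have "s \<in> verts G" using \<open>admissible G s\<close> by (simp add: admissible_def)
  then interpret levelled_graph G s "\<lambda>v. LEAST n. (s, v) \<in> arcs_ends G ^^ n"
    using levelled_graph_distance assms(2) by blast
  show ?thesis
    using BFS_order_AT_free_order BFS_order_monotone_dominating_pair_order assms by blast
qed

end
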